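(* There is a universal constant $K$ such that the following holds. Let $n,l',l''\ge 1$ be integers and $M\ge 0$, and let $\Theta:=\{\theta=(\theta',\theta'')\in\mathbb{R}^{l'}\times\mathbb{R}^{l''}:\Vert\theta\Vert_1\leq M\}$. Let $X'\in\mathbb{R}^{n\times l'}$ and $X''\in\mathbb{R}^{n\times l''}$ be matrices, with $i$-th rows $x_i'$ and $x_i''$ (regarded as vectors) and $i$-th columns $y_i'$ and $y_i''$ respectively, normalized such that $\Vert y_i'\Vert_2=\sqrt{n}$ for all $i=1,\dots,l'$ and $\Vert y_i''\Vert_2=\sqrt{n}$ for all $i=1,\dots,l''$. Let $g:\mathbb{R}^2\to\mathbb{R}$ be a contraction with respect to the Euclidean metric. If there are orthogonal matrices $R',R''\in\mathbb{R}^{n\times n}$ such that $$\sum_{j=1}^n j\,\frac{(R'y_i')_j^2}{n}\leq 1\ \text{ for all } i=1,\dots,l'\qquad\text{and}\qquad \sum_{j=1}^n j\,\frac{(R''y_i'')_j^2}{n}\leq 1\ \text{ for all } i=1,\dots,l'',$$ then for arbitrary $\theta_0=(\theta_0',\theta_0'')\in\Theta$ $$\mathbb{E}\sup_{\theta\in\Theta}\left|\sum_{i=1}^n\epsilon_i\, g\big((x_i')^T\theta',(x_i'')^T\theta''\big)\right|\leq \mathbb{E}\left|\sum_{i=1}^n\epsilon_i\, g\big((x_i')^T\theta_0',(x_i'')^T\theta_0''\big)\right|+K\sqrt{n\log(n+1)}\,M.$$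
   Context: $\epsilon_1,\dots,\epsilon_n$ are i.i.d. Rademacher random variables (each equal to $+1$ or $-1$ with probability $1/2$). A contraction $g:\mathbb{R}^2\to\mathbb{R}$ with respect to the Euclidean metric means $|g(u)-g(v)|\leq\Vert u-v\Vert_2$ for all $u,v\in\mathbb{R}^2$. $(v)_j$ denotes the $j$-th coordinate of a vector $v$. "Universal constant" means $K$ does not depend on $n,l',l'',M,X',X'',g,R',R''$ or $\theta_0$. *)

theory Defs
  imports
    "HOL-Probability.Probability"
    "Jordan_Normal_Form.Matrix"
begin

unbundle no vec_syntax
unbundle no inner_syntax

(* Dimensions range over natural numbers inside the statement (the constant must not depend on
   them), so vectors and matrices are the carrier-based ones of Jordan_Normal_Form; their
   coordinates, rows and columns are numbered from 0. *)

definition l1_norm :: "real vec \<Rightarrow> real" where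
  "l1_norm v = (\<Sum>j<dim_vec v. \<bar>v $ j\<bar>)"

definition l2_norm :: "real vec \<Rightarrow> real" where
  "l2_norm v = L2_set (\<lambda>j. v $ j) {..<dim_vec v}"

(* Genuinely orthogonal (orthonormal columns), unlike the library's orthogonal_mat, which only
   asks for pairwise orthogonal nonzero columns. *)
definition orthogonal_matrices :: "nat \<Rightarrow> real mat set" where
  "orthogonal_matrices n =
     {R \<in> carrier_mat n n. transpose_mat R * R = 1\<^sub>m n \<and> R * transpose_mat R = 1\<^sub>m n}"

definition l1_ball :: "nat \<Rightarrow> nat \<Rightarrow> real \<Rightarrow> (real vec \<times> real vec) set" where
  "l1_ball l' l'' M =
     {(\<theta>', \<theta>'') \<in> carrier_vec l' \<times> carrier_vec l''. l1_norm \<theta>' + l1_norm \<theta>'' \<le> M}"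

(* On the product type real \<times> real the norm is the Euclidean one. *)
definition contraction :: "(real \<times> real \<Rightarrow> real) \<Rightarrow> bool" where
  "contraction g \<longleftrightarrow> (\<forall>u v. \<bar>g u - g v\<bar> \<le> norm (u - v))"

(* The joint law of n i.i.d. Rademacher variables: the expectations in question depend on the
   variables through this law only. Outside {..<n} the sequence is constantly 0. *)
definition rademacher :: "nat \<Rightarrow> (nat \<Rightarrow> real) pmf" where
  "rademacher n = Pi_pmf {..<n} 0 (\<lambda>_. pmf_of_set {-1, 1})"

definition rademacher_sum ::
  "nat \<Rightarrow> real mat \<Rightarrow> real mat \<Rightarrow> (real \<times> real \<Rightarrow> real) \<Rightarrow> (nat \<Rightarrow> real) \<Rightarrow> real vec \<times> real vec \<Rightarrow> real"
where
  "rademacher_sum n X' X'' g \<epsilon> \<theta> =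
     (\<Sum>i<n. \<epsilon> i * g (row X' i \<bullet> fst \<theta>, row X'' i \<bullet> snd \<theta>))"

(* Coordinates j are numbered from 0, hence the weight j + 1. *)
definition column_decay :: "nat \<Rightarrow> real mat \<Rightarrow> real mat \<Rightarrow> bool" where
  "column_decay n R X \<longleftrightarrow>
     (\<forall>i<dim_col X. (\<Sum>j<n. real (j + 1) * ((R *\<^sub>v col X i) $ j)\<^sup>2 / real n) \<le> 1)"

end

theory Submission
  imports Defs
begin

text \<open>
  The hypotheses on the design are rigid. An orthogonal matrix preserves lengths, so the numbers
  \<open>a\<^sub>j = (R y)\<^sub>j\<^sup>2 / n\<close> of a column \<open>y\<close> add up to \<open>1\<close>; if also \<open>\<Sum>j a\<^sub>j \<le> 1\<close> with weights
  \<open>j = 1, 2, \<dots>\<close>, then all the mass sits at \<open>j = 1\<close>. Hence every column is \<open>\<plusminus>\<surd>n\<close> times the first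
  row of \<open>R\<close> (\<open>decaying_column_is_multiple\<close>), and each of the two linear predictors equals
  \<open>s u\<close> for one fixed vector \<open>u\<close> of length \<open>\<surd>n\<close> and a scalar \<open>s\<close> with \<open>\<bar>s\<bar> \<le> \<parallel>\<theta>\<parallel>\<^sub>1\<close>
  (\<open>decaying_design_rank_one\<close>). Whatever the dimensions of \<open>\<theta>'\<close> and \<open>\<theta>''\<close> are, the supremum
  runs over a class with two real parameters in \<open>[-M, M]\<close>.

  Since \<open>g\<close> is a contraction, the vector of values of \<open>g\<close> is a Lipschitz function of the two
  parameters, with constant \<open>\<surd>n\<close> in the Euclidean norm (\<open>contraction_L2_le\<close>). A grid of
  mesh \<open>M / n\<close> therefore is a net of precision \<open>2 M / \<surd>n\<close> with at most
  \<open>(2 n + 1)\<^sup>2\<close> elements (\<open>two_parameter_rademacher_sup_le\<close>). Replacing a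
  point by its grid neighbour changes the Rademacher sum by at most \<open>2 M\<close>, by Cauchy-Schwarz, and the maximum of the increments over the
  grid is a maximum of \<open>O(n\<^sup>2)\<close> sub-Gaussian variables of scale \<open>O(M \<surd>n)\<close>, hence of order
  \<open>M \<surd>(n log (n + 1))\<close> (\<open>rademacher_sup_le_net\<close>). One scale of approximation is enough because the
  bound to be proved contains the logarithm.
\<close>

section \<open>Rademacher sums\<close>

text \<open>
  This is Hoeffding's lemma for a symmetric sign, in the logarithmic form \<open>Hoeffdings_lemma_aux\<close>
  with \<open>p = 1/2\<close> and \<open>h = 2 \<bar>x\<bar>\<close>.
\<close>
lemma cosh_le_exp_half_square: "cosh x \<le> exp (x\<^sup>2 / 2)" for x :: real
proof -
  define h where "h = 2 * \<bar>x\<bar>"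
  have h: "exp h = exp \<bar>x\<bar> * exp \<bar>x\<bar>"
    by (simp add: h_def flip: exp_add)
  have eq: "1 + (1/2) * (exp h - 1) = cosh \<bar>x\<bar> * exp \<bar>x\<bar>"
    by (simp add: h cosh_field_def algebra_simps flip: exp_add)
  have "- h * (1/2) + ln (1 + (1/2) * (exp h - 1)) \<le> h\<^sup>2 / 8"
    by (rule Hoeffdings_lemma_aux) (simp_all add: h_def)
  also have "- h * (1/2) + ln (1 + (1/2) * (exp h - 1)) = ln (cosh \<bar>x\<bar>)"
    unfolding eq by (subst ln_mult_pos) (simp_all add: h_def cosh_real_pos)
  finally have "ln (cosh \<bar>x\<bar>) \<le> x\<^sup>2 / 2"
    by (simp add: h_def power_mult_distrib)
  hence "cosh \<bar>x\<bar> \<le> exp (x\<^sup>2 / 2)"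
    by (metis cosh_real_pos exp_le_cancel_iff exp_ln)
  thus ?thesis by (simp add: abs_if split: if_splits)
qed

lemma set_rademacher: "\<epsilon> \<in> set_pmf (rademacher n) \<Longrightarrow> i < n \<Longrightarrow> \<epsilon> i \<in> {-1, 1}"
  by (auto simp: rademacher_def set_Pi_pmf PiE_dflt_def)

lemma integrable_rademacher [simp]:
  "integrable (measure_pmf (rademacher n)) (f :: (nat \<Rightarrow> real) \<Rightarrow> real)"
  unfolding rademacher_def
  by (intro integrable_measure_pmf_finite) (auto simp: set_Pi_pmf intro!: finite_PiE_dflt)

text \<open>
  Rademacher sums are sub-Gaussian: by independence the moment generating function factors into
  hyperbolic cosines.
\<close>
lemma rademacher_exp_sum_le:
  "measure_pmf.expectation (rademacher n) (\<lambda>\<epsilon>. exp (\<Sum>i<n. \<epsilon> i * a i))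
     \<le> exp ((\<Sum>i<n. (a i)\<^sup>2) / 2)"
proof -
  have "measure_pmf.expectation (rademacher n) (\<lambda>\<epsilon>. exp (\<Sum>i<n. \<epsilon> i * a i)) =
        measure_pmf.expectation (rademacher n) (\<lambda>\<epsilon>. \<Prod>i<n. exp (\<epsilon> i * a i))"
    by (simp add: exp_sum)
  also have "\<dots> = (\<Prod>i<n. measure_pmf.expectation (pmf_of_set {-1, 1}) (\<lambda>s. exp (s * a i)))"
    unfolding rademacher_def
    by (rule expectation_prod_Pi_pmf[where f = "\<lambda>i s. exp (s * a i)"])
       (auto intro!: integrable_measure_pmf_finite)
  also have "\<dots> = (\<Prod>i<n. cosh (a i))"
    by (intro prod.cong) (simp_all add: integral_pmf_of_set cosh_field_def add.commute)
  also have "\<dots> \<le> (\<Prod>i<n. exp ((a i)\<^sup>2 / 2))"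
    by (intro prod_mono conjI cosh_le_exp_half_square) (simp add: cosh_real_nonneg)
  also have "\<dots> = exp ((\<Sum>i<n. (a i)\<^sup>2) / 2)"
    by (simp add: exp_sum sum_divide_distrib)
  finally show ?thesis .
qed

text \<open>
  Cauchy-Schwarz, uniformly in the signs: it controls the error made when a function is replaced
  by its neighbour in a net.
\<close>
lemma rademacher_sum_le_L2:
  assumes "\<epsilon> \<in> set_pmf (rademacher n)"
  shows "\<bar>\<Sum>i<n. \<epsilon> i * a i\<bar> \<le> sqrt (real n) * L2_set a {..<n}"
proof -
  have "(\<Sum>i<n. (\<epsilon> i)\<^sup>2) = (\<Sum>i<n. 1)"
    by (intro sum.cong) (use set_rademacher[OF assms] in force)+
  hence "L2_set \<epsilon> {..<n} = sqrt (real n)"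
    by (simp add: L2_set_def)
  moreover have "\<bar>\<Sum>i<n. \<epsilon> i * a i\<bar> \<le> (\<Sum>i<n. \<bar>\<epsilon> i\<bar> * \<bar>a i\<bar>)"
    by (rule order.trans[OF sum_abs]) (simp add: abs_mult)
  ultimately show ?thesis
    using L2_set_mult_ineq[of \<epsilon> a "{..<n}"] by simp
qed

text \<open>
  The increments from \<open>\<theta>\<^sub>0\<close> to the net are sub-Gaussian, so that the maximum of all of them costs
  only the square root of the logarithm of their number. In place of Jensen's inequality for the
  maximum, the tangent \<open>1 + y \<le> exp y\<close> of the exponential function at a well-chosen point bounds
  every increment by one random variable \<open>W\<close> whose mean is known. As that bound is pointwise in
  the signs, it passes under the supremum.
\<close>
lemma rademacher_sup_le_net:
  fixes f :: "'p \<Rightarrow> nat \<Rightarrow> real" and N :: "(nat \<Rightarrow> real) set"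
  assumes "\<theta>\<^sub>0 \<in> T" and "finite N" and "N \<noteq> {}" and "\<sigma> > 0"
    and net: "\<And>\<theta>. \<theta> \<in> T \<Longrightarrow> \<exists>h\<in>N. L2_set (\<lambda>i. f \<theta> i - h i) {..<n} \<le> \<delta>"
    and radius: "\<And>h. h \<in> N \<Longrightarrow> L2_set (\<lambda>i. h i - f \<theta>\<^sub>0 i) {..<n} \<le> \<sigma>"
  shows "measure_pmf.expectation (rademacher n) (\<lambda>\<epsilon>. SUP \<theta>\<in>T. \<bar>\<Sum>i<n. \<epsilon> i * f \<theta> i\<bar>)
    \<le> measure_pmf.expectation (rademacher n) (\<lambda>\<epsilon>. \<bar>\<Sum>i<n. \<epsilon> i * f \<theta>\<^sub>0 i\<bar>)
       + \<sigma> * sqrt (2 * ln (2 * real (card N))) + sqrt (real n) * \<delta>"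
proof -
  define L where "L = ln (2 * real (card N))"
  have "card N \<ge> 1"
    using assms by (simp add: Suc_leI card_gt_0_iff)
  hence "L > 0" and expL: "exp L = 2 * real (card N)"
    by (simp_all add: L_def)
  \<comment> \<open>This \<open>\<tau>\<close> minimizes \<open>L / \<tau> + \<tau> \<sigma>\<^sup>2 / 2\<close>, the bound that the exponential moments of order
    \<open>\<tau>\<close> give for the expected maximum; the two terms are then equal.\<close>
  define \<tau> where "\<tau> = sqrt (2 * L) / \<sigma>"
  have "\<tau> > 0" using \<open>L > 0\<close> \<open>\<sigma> > 0\<close> by (simp add: \<tau>_def)
  have \<tau>\<sigma>: "\<tau>\<^sup>2 * \<sigma>\<^sup>2 / 2 = L"
    using \<open>L > 0\<close> \<open>\<sigma> > 0\<close> by (simp add: \<tau>_def power_divide)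
  define Y where "Y = (\<lambda>\<epsilon> h. \<Sum>i<n. \<epsilon> i * (h i - f \<theta>\<^sub>0 i))"
  define W where "W = (\<lambda>\<epsilon>. \<Sum>h\<in>N. exp (\<tau> * Y \<epsilon> h) + exp (- \<tau> * Y \<epsilon> h))"
  let ?E = "measure_pmf.expectation (rademacher n)"

  have mgf: "?E (\<lambda>\<epsilon>. exp (t * Y \<epsilon> h)) \<le> exp L" if "h \<in> N" "\<bar>t\<bar> = \<tau>" for h t
  proof -
    have "?E (\<lambda>\<epsilon>. exp (t * Y \<epsilon> h)) = ?E (\<lambda>\<epsilon>. exp (\<Sum>i<n. \<epsilon> i * (t * (h i - f \<theta>\<^sub>0 i))))"
      by (simp add: Y_def sum_distrib_left mult_ac)
    also have "\<dots> \<le> exp ((\<Sum>i<n. (t * (h i - f \<theta>\<^sub>0 i))\<^sup>2) / 2)"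
      by (rule rademacher_exp_sum_le)
    also have "(\<Sum>i<n. (t * (h i - f \<theta>\<^sub>0 i))\<^sup>2) = \<tau>\<^sup>2 * (L2_set (\<lambda>i. h i - f \<theta>\<^sub>0 i) {..<n})\<^sup>2"
      using that(2) by (simp add: L2_set_def sum_nonneg power_mult_distrib sum_distrib_left flip: that(2))
    also have "exp (\<tau>\<^sup>2 * (L2_set (\<lambda>i. h i - f \<theta>\<^sub>0 i) {..<n})\<^sup>2 / 2) \<le> exp (\<tau>\<^sup>2 * \<sigma>\<^sup>2 / 2)"
      using radius[OF that(1)] by (simp add: mult_left_mono power_mono)
    finally show ?thesis by (simp add: \<tau>\<sigma>)
  qed
  have "?E W = (\<Sum>h\<in>N. ?E (\<lambda>\<epsilon>. exp (\<tau> * Y \<epsilon> h)) + ?E (\<lambda>\<epsilon>. exp (- \<tau> * Y \<epsilon> h)))"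
    by (simp add: W_def Bochner_Integration.integral_sum Bochner_Integration.integral_add)
  also have "\<dots> \<le> (\<Sum>h\<in>N. exp L + exp L)"
    using \<open>\<tau> > 0\<close> by (intro sum_mono add_mono mgf) auto
  also have "\<dots> = exp L * exp L"
    unfolding expL by simp
  also have "\<dots> = exp (2 * L)"
    by (simp flip: exp_add)
  finally have EW: "?E W \<le> exp (2 * L)" .

  \<comment> \<open>The tangent is taken where \<open>\<tau> \<bar>Y\<bar> = 2 L\<close>, because \<open>exp (2 L)\<close> is the bound on the mean of \<open>W\<close>:
    in the mean, the first and the last summand on the right then add up to at most \<open>0\<close>.\<close>
  have *: "\<bar>Y \<epsilon> h\<bar> \<le> (W \<epsilon> / exp (2 * L) + 2 * L - 1) / \<tau>" if "h \<in> N" for \<epsilon> h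
  proof -
    have "\<tau> * \<bar>Y \<epsilon> h\<bar> - 2 * L + 1 \<le> exp (\<tau> * \<bar>Y \<epsilon> h\<bar> - 2 * L)"
      using exp_ge_add_one_self[of "\<tau> * \<bar>Y \<epsilon> h\<bar> - 2 * L"] by linarith
    also have "\<dots> = exp (\<tau> * \<bar>Y \<epsilon> h\<bar>) / exp (2 * L)"
      by (simp add: exp_diff)
    also have "exp (\<tau> * \<bar>Y \<epsilon> h\<bar>) \<le> exp (\<tau> * Y \<epsilon> h) + exp (- \<tau> * Y \<epsilon> h)"
      by (cases "Y \<epsilon> h \<ge> 0") (auto simp: abs_if)
    also have "\<dots> \<le> W \<epsilon>"
      unfolding W_def using that \<open>finite N\<close> by (intro member_le_sum) (auto intro: add_nonneg_nonneg)
    finally show ?thesis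
      using \<open>\<tau> > 0\<close> by (simp add: field_simps divide_right_mono)
  qed

  have "?E (\<lambda>\<epsilon>. SUP \<theta>\<in>T. \<bar>\<Sum>i<n. \<epsilon> i * f \<theta> i\<bar>)
      \<le> ?E (\<lambda>\<epsilon>. \<bar>\<Sum>i<n. \<epsilon> i * f \<theta>\<^sub>0 i\<bar> + ((W \<epsilon> / exp (2 * L) + 2 * L - 1) / \<tau> + sqrt (real n) * \<delta>))"
  proof (rule integral_mono_AE)
    show "AE \<epsilon> in rademacher n. (SUP \<theta>\<in>T. \<bar>\<Sum>i<n. \<epsilon> i * f \<theta> i\<bar>)
      \<le> \<bar>\<Sum>i<n. \<epsilon> i * f \<theta>\<^sub>0 i\<bar> + ((W \<epsilon> / exp (2 * L) + 2 * L - 1) / \<tau> + sqrt (real n) * \<delta>)"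
    proof (rule AE_pmfI, rule cSUP_least)
      show "T \<noteq> {}" using assms(1) by auto
      fix \<epsilon> \<theta> assume \<epsilon>: "\<epsilon> \<in> set_pmf (rademacher n)" and "\<theta> \<in> T"
      obtain h where h: "h \<in> N" "L2_set (\<lambda>i. f \<theta> i - h i) {..<n} \<le> \<delta>"
        using net[OF \<open>\<theta> \<in> T\<close>] by blast
      have "(\<Sum>i<n. \<epsilon> i * f \<theta> i) =
          (\<Sum>i<n. \<epsilon> i * f \<theta>\<^sub>0 i) + Y \<epsilon> h + (\<Sum>i<n. \<epsilon> i * (f \<theta> i - h i))"
        by (simp add: Y_def algebra_simps sum.distrib sum_subtractf)
      moreover have "\<bar>\<Sum>i<n. \<epsilon> i * (f \<theta> i - h i)\<bar> \<le> sqrt (real n) * \<delta>"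
        by (rule order.trans[OF rademacher_sum_le_L2[OF \<epsilon>]]) (use h in \<open>simp add: mult_left_mono\<close>)
      ultimately show "\<bar>\<Sum>i<n. \<epsilon> i * f \<theta> i\<bar> \<le> \<bar>\<Sum>i<n. \<epsilon> i * f \<theta>\<^sub>0 i\<bar>
          + ((W \<epsilon> / exp (2 * L) + 2 * L - 1) / \<tau> + sqrt (real n) * \<delta>)"
        using *[OF h(1), of \<epsilon>] by linarith
    qed
  qed simp_all
  also have "\<dots> = ?E (\<lambda>\<epsilon>. \<bar>\<Sum>i<n. \<epsilon> i * f \<theta>\<^sub>0 i\<bar>)
      + ((?E W / exp (2 * L) + 2 * L - 1) / \<tau> + sqrt (real n) * \<delta>)"
    by simp
  also have "(?E W / exp (2 * L) + 2 * L - 1) / \<tau> \<le> 2 * L / \<tau>"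
    using EW \<open>\<tau> > 0\<close> by (intro divide_right_mono) simp_all
  also have "2 * L / \<tau> = \<sigma> * sqrt (2 * L)"
    using \<open>L > 0\<close> \<open>\<sigma> > 0\<close> by (simp add: \<tau>_def field_simps)
  finally show ?thesis by (simp add: L_def add_ac)
qed

section \<open>The design has rank one\<close>

text \<open>
  Since \<open>R\<close> is an isometry, the squared coordinates of \<open>R v\<close> add up to \<open>n\<close>; subtracting this from
  the weighted sum leaves \<open>\<Sum>j (R v)\<^sub>j\<^sup>2 \<le> 0\<close> over \<open>j < n\<close>, so that only the coordinate of index
  \<open>0\<close> survives. Transforming back gives a multiple of the first row of \<open>R\<close>.
\<close>
lemma decaying_column_is_multiple:
  assumes R: "R \<in> orthogonal_matrices n" and v: "v \<in> carrier_vec n" and "n \<ge> 1"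
    and norm: "l2_norm v = sqrt (real n)"
    and decay: "(\<Sum>j<n. real (j + 1) * ((R *\<^sub>v v) $ j)\<^sup>2 / real n) \<le> 1"
  shows "\<exists>c. \<bar>c\<bar> = sqrt (real n) \<and> (\<forall>i<n. v $ i = c * R $$ (0, i))"
proof -
  define w where "w = R *\<^sub>v v"
  have Rc: "R \<in> carrier_mat n n" and RR: "transpose_mat R * R = 1\<^sub>m n"
    using R by (auto simp: orthogonal_matrices_def)
  have w: "w \<in> carrier_vec n" using Rc v by (simp add: w_def)
  have v_eq: "v = transpose_mat R *\<^sub>v w"
    unfolding w_def using Rc v RR by (subst assoc_mult_mat_vec[symmetric]) auto
  have "w \<bullet> w = v \<bullet> v"
    using transpose_vec_mult_scalar[OF Rc v w] unfolding v_eq[symmetric] w_def[symmetric] by simp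
  hence sq: "(\<Sum>j<n. (w $ j)\<^sup>2) = (\<Sum>j<n. (v $ j)\<^sup>2)"
    using v w by (simp add: scalar_prod_def power2_eq_square atLeast0LessThan)
  have "sqrt (\<Sum>j<n. (v $ j)\<^sup>2) = sqrt (real n)"
    using norm v by (simp add: l2_norm_def L2_set_def)
  with sq have sum_w: "(\<Sum>j<n. (w $ j)\<^sup>2) = real n"
    by simp
  have "(\<Sum>j<n. real (j + 1) * (w $ j)\<^sup>2) \<le> real n"
    using decay \<open>n \<ge> 1\<close> by (simp add: w_def field_simps flip: sum_divide_distrib)
  hence "(\<Sum>j<n. real j * (w $ j)\<^sup>2) \<le> 0"
    using sum_w by (simp add: algebra_simps sum.distrib)
  moreover have "(\<Sum>j<n. real j * (w $ j)\<^sup>2) \<ge> 0"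
    by (intro sum_nonneg) auto
  ultimately have "(\<Sum>j<n. real j * (w $ j)\<^sup>2) = 0" by linarith
  hence vanish: "\<forall>j\<in>{..<n}. real j * (w $ j)\<^sup>2 = 0"
    by (subst (asm) sum_nonneg_eq_0_iff) auto
  have zero: "w $ j = 0" if "j < n" "j \<noteq> 0" for j
    using bspec[OF vanish, of j] that by simp
  have split: "(\<Sum>j<n. a j) = a 0" if "\<And>j. j < n \<Longrightarrow> j \<noteq> 0 \<Longrightarrow> a j = 0" for a :: "nat \<Rightarrow> real"
    using that \<open>n \<ge> 1\<close> sum.mono_neutral_right[of "{..<n}" "{0}" a] by auto
  have "(w $ 0)\<^sup>2 = real n"
    using sum_w split[of "\<lambda>j. (w $ j)\<^sup>2"] zero by simp
  hence "\<bar>w $ 0\<bar> = sqrt (real n)"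
    by (metis real_sqrt_abs)
  moreover have "v $ i = w $ 0 * R $$ (0, i)" if "i < n" for i
  proof -
    have "v $ i = (\<Sum>j<n. R $$ (j, i) * w $ j)"
      by (subst v_eq) (use Rc w that in \<open>simp add: scalar_prod_def atLeast0LessThan\<close>)
    also have "\<dots> = R $$ (0, i) * w $ 0"
      by (rule split) (simp add: zero)
    finally show ?thesis by (simp add: mult.commute)
  qed
  ultimately show ?thesis by blast
qed

text \<open>
  All columns are multiples \<open>c\<^sub>k\<close> of the same unit vector, with \<open>\<bar>c\<^sub>k\<bar> = \<surd>n\<close>; so the scalar
  \<open>s \<theta> = \<Sum>k. (c\<^sub>k / \<surd>n) \<theta>\<^sub>k\<close> is a signed sum of the coordinates of \<open>\<theta>\<close>, which the \<open>l\<^sub>1\<close> norm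
  bounds.
\<close>
lemma decaying_design_rank_one:
  assumes R: "R \<in> orthogonal_matrices n" and X: "X \<in> carrier_mat n l" and "n \<ge> 1"
    and norm: "\<forall>i<l. l2_norm (col X i) = sqrt (real n)"
    and decay: "column_decay n R X"
  shows "\<exists>u s. L2_set u {..<n} = sqrt (real n) \<and>
    (\<forall>\<theta>\<in>carrier_vec l. \<bar>s \<theta>\<bar> \<le> l1_norm \<theta> \<and> (\<forall>i<n. row X i \<bullet> \<theta> = s \<theta> * u i))"
proof -
  have "\<exists>c. \<bar>c\<bar> = sqrt (real n) \<and> (\<forall>i<n. col X k $ i = c * R $$ (0, i))" if "k < l" for k
    using that X R norm decay \<open>n \<ge> 1\<close>
    by (intro decaying_column_is_multiple) (auto simp: column_decay_def)
  then obtain c where c: "\<And>k. k < l \<Longrightarrow> \<bar>c k\<bar> = sqrt (real n)"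
      "\<And>k i. k < l \<Longrightarrow> i < n \<Longrightarrow> col X k $ i = c k * R $$ (0, i)"
    by metis
  define u where "u = (\<lambda>i. sqrt (real n) * R $$ (0, i))"
  define s where "s = (\<lambda>\<theta>. \<Sum>k<l. c k / sqrt (real n) * \<theta> $ k)"
  have Rc: "R \<in> carrier_mat n n" and RR: "R * transpose_mat R = 1\<^sub>m n"
    using R by (auto simp: orthogonal_matrices_def)
  have "(\<Sum>i<n. (R $$ (0, i))\<^sup>2) = (R * transpose_mat R) $$ (0, 0)"
    using Rc \<open>n \<ge> 1\<close> by (simp add: scalar_prod_def power2_eq_square atLeast0LessThan)
  also have "\<dots> = 1" using RR \<open>n \<ge> 1\<close> by simp
  finally have "L2_set u {..<n} = sqrt (real n)"
    by (simp add: u_def L2_set_def power_mult_distrib flip: sum_distrib_left)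
  moreover have "\<bar>s \<theta>\<bar> \<le> l1_norm \<theta>" if "\<theta> \<in> carrier_vec l" for \<theta>
  proof -
    have "\<bar>s \<theta>\<bar> \<le> (\<Sum>k<l. \<bar>c k / sqrt (real n) * \<theta> $ k\<bar>)"
      unfolding s_def by (rule sum_abs)
    also have "\<dots> = (\<Sum>k<l. \<bar>\<theta> $ k\<bar>)"
      using c(1) \<open>n \<ge> 1\<close> by (intro sum.cong) (simp_all add: abs_mult)
    finally show ?thesis using that by (simp add: l1_norm_def)
  qed
  moreover have "row X i \<bullet> \<theta> = s \<theta> * u i" if "\<theta> \<in> carrier_vec l" "i < n" for \<theta> i
  proof -
    have "row X i \<bullet> \<theta> = (\<Sum>k<l. col X k $ i * \<theta> $ k)"
      using that X by (simp add: scalar_prod_def atLeast0LessThan)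
    also have "\<dots> = (\<Sum>k<l. c k / sqrt (real n) * \<theta> $ k * u i)"
      using c(2) that \<open>n \<ge> 1\<close> by (intro sum.cong) (simp_all add: u_def)
    finally show ?thesis by (simp add: s_def sum_distrib_right)
  qed
  ultimately show ?thesis by blast
qed

section \<open>Contractions of two rank-one predictors\<close>

lemma contraction_L2_le:
  assumes "contraction g" and "L2_set u' A = r" and "L2_set u'' A = r"
  shows "L2_set (\<lambda>i. g (s * u' i, t * u'' i) - g (s\<^sub>0 * u' i, t\<^sub>0 * u'' i)) A
    \<le> (\<bar>s - s\<^sub>0\<bar> + \<bar>t - t\<^sub>0\<bar>) * r"
proof -
  have "L2_set (\<lambda>i. g (s * u' i, t * u'' i) - g (s\<^sub>0 * u' i, t\<^sub>0 * u'' i)) A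
      = L2_set (\<lambda>i. \<bar>g (s * u' i, t * u'' i) - g (s\<^sub>0 * u' i, t\<^sub>0 * u'' i)\<bar>) A"
    by (simp add: L2_set_def)
  also have "\<dots> \<le> L2_set (\<lambda>i. \<bar>s - s\<^sub>0\<bar> * \<bar>u' i\<bar> + \<bar>t - t\<^sub>0\<bar> * \<bar>u'' i\<bar>) A"
  proof (rule L2_set_mono)
    fix i
    have "\<bar>g (s * u' i, t * u'' i) - g (s\<^sub>0 * u' i, t\<^sub>0 * u'' i)\<bar>
        \<le> norm ((s - s\<^sub>0) * u' i, (t - t\<^sub>0) * u'' i)"
      using assms(1) unfolding contraction_def
      by (metis (no_types, lifting) diff_Pair left_diff_distrib)
    also have "\<dots> \<le> \<bar>s - s\<^sub>0\<bar> * \<bar>u' i\<bar> + \<bar>t - t\<^sub>0\<bar> * \<bar>u'' i\<bar>"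
      using norm_Pair_le[of "(s - s\<^sub>0) * u' i" "(t - t\<^sub>0) * u'' i"] by (simp add: abs_mult)
    finally show "\<bar>g (s * u' i, t * u'' i) - g (s\<^sub>0 * u' i, t\<^sub>0 * u'' i)\<bar>
        \<le> \<bar>s - s\<^sub>0\<bar> * \<bar>u' i\<bar> + \<bar>t - t\<^sub>0\<bar> * \<bar>u'' i\<bar>" .
  qed simp
  also have "\<dots> \<le> L2_set (\<lambda>i. \<bar>s - s\<^sub>0\<bar> * \<bar>u' i\<bar>) A + L2_set (\<lambda>i. \<bar>t - t\<^sub>0\<bar> * \<bar>u'' i\<bar>) A"
    by (rule L2_set_triangle_ineq)
  also have "\<dots> = (\<bar>s - s\<^sub>0\<bar> + \<bar>t - t\<^sub>0\<bar>) * r"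
    using assms(2,3) by (simp add: L2_set_right_distrib[symmetric] distrib_right) (simp add: L2_set_def)
  finally show ?thesis .
qed

lemma grid_approximation:
  fixes M s :: real
  assumes "M > 0" and "n \<ge> 1" and "\<bar>s\<bar> \<le> M"
  shows "\<exists>a\<in>{- int n..int n}. \<bar>s - M * a / n\<bar> \<le> M / n"
proof
  define x where "x = s * n / M"
  have x: "\<bar>x\<bar> \<le> n"
    using assms by (simp add: x_def abs_mult field_simps)
  show "\<lfloor>x\<rfloor> \<in> {- int n..int n}"
    using x by (simp add: le_floor_iff floor_le_iff) linarith
  have "s - M * \<lfloor>x\<rfloor> / n = M / n * (x - \<lfloor>x\<rfloor>)"
    using assms by (simp add: x_def field_simps)
  moreover have "\<bar>x - \<lfloor>x\<rfloor>\<bar> \<le> 1" by linarith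
  ultimately show "\<bar>s - M * \<lfloor>x\<rfloor> / n\<bar> \<le> M / n"
    using mult_left_mono[of "\<bar>x - \<lfloor>x\<rfloor>\<bar>" 1 "M / n"] \<open>M > 0\<close> by (simp only: abs_mult) simp
qed

text \<open>
  The net consists of the functions that belong to the points of a square grid in \<open>[-M, M]\<^sup>2\<close>.
  These points need not be parameters of elements of \<open>T\<close>, which is why
  \<open>rademacher_sup_le_net\<close> asks for a net of functions instead of a subset of \<open>T\<close>.
\<close>
lemma two_parameter_rademacher_sup_le:
  fixes T :: "'p set" and s t :: "'p \<Rightarrow> real"
  assumes "n \<ge> 1" and "M > 0" and "contraction g" and "\<theta>\<^sub>0 \<in> T"
    and u: "L2_set u' {..<n} = sqrt (real n)" "L2_set u'' {..<n} = sqrt (real n)"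
    and T: "\<And>\<theta>. \<theta> \<in> T \<Longrightarrow> \<bar>s \<theta>\<bar> \<le> M" "\<And>\<theta>. \<theta> \<in> T \<Longrightarrow> \<bar>t \<theta>\<bar> \<le> M"
  shows "measure_pmf.expectation (rademacher n)
      (\<lambda>\<epsilon>. SUP \<theta>\<in>T. \<bar>\<Sum>i<n. \<epsilon> i * g (s \<theta> * u' i, t \<theta> * u'' i)\<bar>)
    \<le> measure_pmf.expectation (rademacher n)
        (\<lambda>\<epsilon>. \<bar>\<Sum>i<n. \<epsilon> i * g (s \<theta>\<^sub>0 * u' i, t \<theta>\<^sub>0 * u'' i)\<bar>)
      + 20 * sqrt (real n * ln (real n + 1)) * M"
proof -
  define F where "F = (\<lambda>(a::real, b::real) i. g (a * u' i, b * u'' i))"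
  define G where "G = {- int n..int n} \<times> {- int n..int n}"
  define p where "p = (\<lambda>(a::int, b::int). (M * a / n, M * b / n))"
  define N where "N = (\<lambda>q. F (p q)) ` G"
  have finG: "finite G" and "G \<noteq> {}" by (auto simp: G_def)
  have N: "finite N" "N \<noteq> {}" using finG \<open>G \<noteq> {}\<close> by (auto simp: N_def)
  have "card N \<le> card G" unfolding N_def by (rule card_image_le[OF finG])
  also have "card G = (2 * n + 1)\<^sup>2"
    by (simp add: G_def card_cartesian_product power2_eq_square nat_add_distrib nat_mult_distrib)
  finally have cardN: "card N \<le> (2 * n + 1)\<^sup>2" .
  have "0 < card N" using N by (simp add: card_gt_0_iff)

  have cover: "\<exists>h\<in>N. L2_set (\<lambda>i. F (s \<theta>, t \<theta>) i - h i) {..<n} \<le> 2 * M / sqrt (real n)"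
    if \<theta>: "\<theta> \<in> T" for \<theta>
  proof -
    obtain a where a: "a \<in> {- int n..int n}" "\<bar>s \<theta> - M * a / n\<bar> \<le> M / n"
      using grid_approximation[OF \<open>M > 0\<close> \<open>n \<ge> 1\<close> T(1)[OF \<theta>]] by blast
    obtain b where b: "b \<in> {- int n..int n}" "\<bar>t \<theta> - M * b / n\<bar> \<le> M / n"
      using grid_approximation[OF \<open>M > 0\<close> \<open>n \<ge> 1\<close> T(2)[OF \<theta>]] by blast
    have "L2_set (\<lambda>i. F (s \<theta>, t \<theta>) i - F (p (a, b)) i) {..<n}
        \<le> (\<bar>s \<theta> - M * a / n\<bar> + \<bar>t \<theta> - M * b / n\<bar>) * sqrt (real n)"
      unfolding F_def p_def prod.case by (rule contraction_L2_le[OF \<open>contraction g\<close> u])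
    also have "\<dots> \<le> (M / n + M / n) * sqrt (real n)"
      using a b by (intro mult_right_mono add_mono) auto
    also have "\<dots> = 2 * M / sqrt (real n)"
      using \<open>n \<ge> 1\<close> by (simp add: field_simps real_sqrt_mult_self)
    finally show ?thesis
      using a(1) b(1) unfolding N_def G_def by blast
  qed
  have radius: "L2_set (\<lambda>i. h i - F (s \<theta>\<^sub>0, t \<theta>\<^sub>0) i) {..<n} \<le> 4 * M * sqrt (real n)" if h: "h \<in> N" for h
  proof -
    obtain a b where ab: "a \<in> {- int n..int n}" "b \<in> {- int n..int n}" "h = F (p (a, b))"
      using h unfolding N_def G_def by blast
    have grid: "\<bar>M * c / n\<bar> \<le> M" if "c \<in> {- int n..int n}" for c :: int
    proof -
      have "\<bar>real_of_int c\<bar> \<le> real n" using that by auto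
      thus ?thesis
        using \<open>M > 0\<close> \<open>n \<ge> 1\<close> by (simp add: abs_mult field_simps)
    qed
    have "L2_set (\<lambda>i. h i - F (s \<theta>\<^sub>0, t \<theta>\<^sub>0) i) {..<n}
        \<le> (\<bar>M * a / n - s \<theta>\<^sub>0\<bar> + \<bar>M * b / n - t \<theta>\<^sub>0\<bar>) * sqrt (real n)"
      unfolding ab(3) F_def p_def prod.case by (rule contraction_L2_le[OF \<open>contraction g\<close> u])
    also have "\<bar>M * a / n - s \<theta>\<^sub>0\<bar> + \<bar>M * b / n - t \<theta>\<^sub>0\<bar> \<le> 4 * M"
      using grid[OF ab(1)] grid[OF ab(2)] T[OF \<open>\<theta>\<^sub>0 \<in> T\<close>] by linarith
    finally show ?thesis by (simp add: mult_right_mono)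
  qed

  define \<Lambda> where "\<Lambda> = ln (real n + 1)"
  have "1 / 2 \<le> ln (2::real)"
    using ln2_ge_two_thirds by simp
  also have "ln 2 \<le> \<Lambda>" using \<open>n \<ge> 1\<close> by (simp add: \<Lambda>_def)
  finally have "1 / 2 \<le> \<Lambda>" .
  \<comment> \<open>Both \<open>2 \<le> n + 1\<close> and \<open>2 n + 1 \<le> (n + 1)\<^sup>2\<close>, so the logarithm of twice the size of the net
    is at most \<open>5 \<Lambda>\<close>; rounding \<open>2 * 5\<close> up to \<open>16\<close> makes the square root rational. The final constant is
    \<open>20 = 4 * 4 + 4\<close>, from the maximum over the net and from the approximation error.\<close>
  have "2 * n + 1 \<le> (n + 1)\<^sup>2"
    by (simp add: power2_eq_square)
  hence "(2 * n + 1)\<^sup>2 \<le> ((n + 1)\<^sup>2)\<^sup>2"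
    by (rule power_mono) simp
  with cardN have "card N \<le> ((n + 1)\<^sup>2)\<^sup>2"
    by (rule order.trans)
  hence "2 * card N \<le> (n + 1) * ((n + 1)\<^sup>2)\<^sup>2"
    using \<open>n \<ge> 1\<close> by (intro mult_le_mono) simp_all
  also have "\<dots> = (n + 1) ^ 5"
    using power_add[of "n + 1" 1 4] power_mult[of "n + 1" 2 2] by simp
  finally have "real (2 * card N) \<le> real ((n + 1) ^ 5)"
    by (simp only: of_nat_le_iff)
  hence "ln (2 * real (card N)) \<le> ln ((real n + 1) ^ 5)"
    using \<open>0 < card N\<close> by (subst ln_le_cancel_iff) (simp_all add: add.commute)
  also have "\<dots> = 5 * \<Lambda>"
    by (simp add: \<Lambda>_def ln_realpow)
  finally have "sqrt (2 * ln (2 * real (card N))) \<le> sqrt (16 * \<Lambda>)"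
    using \<open>1 / 2 \<le> \<Lambda>\<close> by simp
  hence "4 * M * sqrt (real n) * sqrt (2 * ln (2 * real (card N)))
      \<le> 4 * M * sqrt (real n) * (4 * sqrt \<Lambda>)"
    using \<open>M > 0\<close> by (intro mult_left_mono) (simp_all add: real_sqrt_mult)
  moreover have "sqrt (real n) * (2 * M / sqrt (real n)) \<le> 4 * M * sqrt (real n) * sqrt \<Lambda>"
  proof -
    have "1 / 2 \<le> sqrt (real n) * sqrt \<Lambda>"
    proof -
      have "(1 / 2)\<^sup>2 \<le> 1 * \<Lambda>" using \<open>1 / 2 \<le> \<Lambda>\<close> by (simp add: power2_eq_square)
      also have "\<dots> \<le> real n * \<Lambda>" using \<open>n \<ge> 1\<close> \<open>1 / 2 \<le> \<Lambda>\<close> by (intro mult_right_mono) auto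
      finally show ?thesis
        unfolding real_sqrt_mult[symmetric] by (rule real_le_rsqrt)
    qed
    from mult_left_mono[OF this, of "4 * M"] show ?thesis
      using \<open>M > 0\<close> \<open>n \<ge> 1\<close> by (simp add: mult_ac)
  qed
  ultimately have "4 * M * sqrt (real n) * sqrt (2 * ln (2 * real (card N)))
      + sqrt (real n) * (2 * M / sqrt (real n)) \<le> 20 * sqrt (real n * \<Lambda>) * M"
    by (simp add: real_sqrt_mult mult_ac)
  moreover have "4 * M * sqrt (real n) > 0"
    using \<open>M > 0\<close> \<open>n \<ge> 1\<close> by simp
  note rademacher_sup_le_net[where f = "\<lambda>\<theta>. F (s \<theta>, t \<theta>)", OF \<open>\<theta>\<^sub>0 \<in> T\<close> N this cover radius]
  ultimately show ?thesis
    unfolding F_def \<Lambda>_def by simp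
qed

theorem theorem1p3:
  shows "\<exists>K::real. \<forall>(n::nat) (l'::nat) (l''::nat) (M::real)
           (X'::real mat) (X''::real mat) (g::real \<times> real \<Rightarrow> real).
     n \<ge> 1 \<longrightarrow> l' \<ge> 1 \<longrightarrow> l'' \<ge> 1 \<longrightarrow> M \<ge> 0 \<longrightarrow>
     X' \<in> carrier_mat n l' \<longrightarrow> X'' \<in> carrier_mat n l'' \<longrightarrow>
     (\<forall>i<l'. l2_norm (col X' i) = sqrt (real n)) \<longrightarrow>
     (\<forall>i<l''. l2_norm (col X'' i) = sqrt (real n)) \<longrightarrow>
     contraction g \<longrightarrow>
     (\<exists>R'\<in>orthogonal_matrices n. \<exists>R''\<in>orthogonal_matrices n.
        column_decay n R' X' \<and> column_decay n R'' X'') \<longrightarrow>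
     (\<forall>\<theta>\<^sub>0\<in>l1_ball l' l'' M.
        measure_pmf.expectation (rademacher n)
          (\<lambda>\<epsilon>. SUP \<theta>\<in>l1_ball l' l'' M. \<bar>rademacher_sum n X' X'' g \<epsilon> \<theta>\<bar>)
        \<le> measure_pmf.expectation (rademacher n)
            (\<lambda>\<epsilon>. \<bar>rademacher_sum n X' X'' g \<epsilon> \<theta>\<^sub>0\<bar>)
          + K * sqrt (real n * ln (real n + 1)) * M)"
proof (intro exI[of _ 20] allI impI ballI)
  fix n l' l'' M X' X'' g \<theta>\<^sub>0
  assume "n \<ge> 1" "M \<ge> 0" and X: "X' \<in> carrier_mat n l'" "X'' \<in> carrier_mat n l''"
    and norm: "\<forall>i<l'. l2_norm (col X' i) = sqrt (real n)" "\<forall>i<l''. l2_norm (col X'' i) = sqrt (real n)"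
    and "contraction g" and \<theta>\<^sub>0: "\<theta>\<^sub>0 \<in> l1_ball l' l'' M"
    and "\<exists>R'\<in>orthogonal_matrices n. \<exists>R''\<in>orthogonal_matrices n.
        column_decay n R' X' \<and> column_decay n R'' X''"
  then obtain R' R'' where R: "R' \<in> orthogonal_matrices n" "column_decay n R' X'"
      "R'' \<in> orthogonal_matrices n" "column_decay n R'' X''" by blast
  obtain u' s where s: "L2_set u' {..<n} = sqrt (real n)"
      "\<And>\<theta>. \<theta> \<in> carrier_vec l' \<Longrightarrow> \<bar>s \<theta>\<bar> \<le> l1_norm \<theta>"
      "\<And>\<theta> i. \<theta> \<in> carrier_vec l' \<Longrightarrow> i < n \<Longrightarrow> row X' i \<bullet> \<theta> = s \<theta> * u' i"
    using decaying_design_rank_one[OF R(1) X(1) \<open>n \<ge> 1\<close> norm(1) R(2)] by blast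
  obtain u'' t where t: "L2_set u'' {..<n} = sqrt (real n)"
      "\<And>\<theta>. \<theta> \<in> carrier_vec l'' \<Longrightarrow> \<bar>t \<theta>\<bar> \<le> l1_norm \<theta>"
      "\<And>\<theta> i. \<theta> \<in> carrier_vec l'' \<Longrightarrow> i < n \<Longrightarrow> row X'' i \<bullet> \<theta> = t \<theta> * u'' i"
    using decaying_design_rank_one[OF R(3) X(2) \<open>n \<ge> 1\<close> norm(2) R(4)] by blast
  let ?T = "l1_ball l' l'' M"
  have bound: "\<bar>s (fst \<theta>)\<bar> + \<bar>t (snd \<theta>)\<bar> \<le> M" if "\<theta> \<in> ?T" for \<theta>
    using that s(2)[of "fst \<theta>"] t(2)[of "snd \<theta>"] by (auto simp: l1_ball_def)
  have sum: "rademacher_sum n X' X'' g \<epsilon> \<theta> =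
      (\<Sum>i<n. \<epsilon> i * g (s (fst \<theta>) * u' i, t (snd \<theta>) * u'' i))" if "\<theta> \<in> ?T" for \<epsilon> \<theta>
    using that by (auto simp: rademacher_sum_def l1_ball_def s(3) t(3) intro!: sum.cong)
  show "measure_pmf.expectation (rademacher n)
          (\<lambda>\<epsilon>. SUP \<theta>\<in>?T. \<bar>rademacher_sum n X' X'' g \<epsilon> \<theta>\<bar>)
        \<le> measure_pmf.expectation (rademacher n)
            (\<lambda>\<epsilon>. \<bar>rademacher_sum n X' X'' g \<epsilon> \<theta>\<^sub>0\<bar>)
          + 20 * sqrt (real n * ln (real n + 1)) * M"
  proof (cases "M = 0")
    \<comment> \<open>For \<open>M = 0\<close> the grid degenerates, but so does the supremum.\<close>
    case True
    have zero: "s (fst \<theta>) = 0 \<and> t (snd \<theta>) = 0" if "\<theta> \<in> ?T" for \<theta>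
      using bound[OF that] True by auto
    have "rademacher_sum n X' X'' g \<epsilon> \<theta> = rademacher_sum n X' X'' g \<epsilon> \<theta>\<^sub>0" if "\<theta> \<in> ?T" for \<epsilon> \<theta>
      using zero[OF that] zero[OF \<theta>\<^sub>0] by (simp add: sum[OF that] sum[OF \<theta>\<^sub>0])
    hence "(\<lambda>\<theta>. \<bar>rademacher_sum n X' X'' g \<epsilon> \<theta>\<bar>) ` ?T = {\<bar>rademacher_sum n X' X'' g \<epsilon> \<theta>\<^sub>0\<bar>}" for \<epsilon>
      using \<theta>\<^sub>0 by (metis (no_types, lifting) image_cong image_constant)
    with True show ?thesis by simp
  next
    case False
    have "measure_pmf.expectation (rademacher n)
          (\<lambda>\<epsilon>. SUP \<theta>\<in>?T. \<bar>\<Sum>i<n. \<epsilon> i * g (s (fst \<theta>) * u' i, t (snd \<theta>) * u'' i)\<bar>)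
        \<le> measure_pmf.expectation (rademacher n)
            (\<lambda>\<epsilon>. \<bar>\<Sum>i<n. \<epsilon> i * g (s (fst \<theta>\<^sub>0) * u' i, t (snd \<theta>\<^sub>0) * u'' i)\<bar>)
          + 20 * sqrt (real n * ln (real n + 1)) * M"
      using False \<open>M \<ge> 0\<close> bound
      by (intro two_parameter_rademacher_sup_le[OF \<open>n \<ge> 1\<close> _ \<open>contraction g\<close> \<theta>\<^sub>0 s(1) t(1)]) force+
    thus ?thesis
      by (simp add: sum[OF \<theta>\<^sub>0] sum cong: image_cong_simp)
  qed
qed

end
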